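(* Let $\Delta=\bigcap_{i=1}^N\{x\in\mathfrak t^*\mid\langle\eta_i,x\rangle\le\kappa_i\}\subset\mathfrak t^*$ be a simple polytope and let $\mathcal I$ denote the set of equivalence classes of its facets. If $H\in\mathfrak t$ is inessential, write $H=\sum_i\beta_i\eta_i$ with $\beta_i\in\mathbb R$ for all $i$ and $\sum_{i\in I}\beta_i=0$ for all $I\in\mathcal I$. Then $$\langle H,c_\Delta(\kappa)\rangle=\sum_i\beta_i\kappa_i\qquad(\kappa\in\mathcal C_\Delta).$$
   Context: Let $\mathfrak t$ be a finite-dimensional real vector space with dual $\mathfrak t^*$ and pairing $\langle\cdot,\cdot\rangle$. A polytope is a bounded set $\Delta=\bigcap_{i=1}^N\{x\in\mathfrak t^*\mid\langle\eta_i,x\rangle\le\kappa_i\}$ with outward conormals $\eta_i\in\mathfrak t$ and support numbers $\kappa_i\in\mathbb R$, where $\Delta$ affinely spans $\mathfrak t^*$ and each facet $F_i=\Delta\cap\{\langle\eta_i,x\rangle=\kappa_i\}$ affinely spans a hyperplane. It is simple if exactly $\dim\mathfrak t$ facets meet at each vertex. With the $\eta_i$ fixed, for $\kappa'\in\mathbb R^N$ let $\Delta(\kappa')=\bigcap_i\{\langle\eta_i,x\rangle\le\kappa'_i\}$, with facets $F_i(\kappa')$. The chamber $\mathcal C_\Delta\subset\mathbb R^N$ is the connected component, containing the given $\kappa$, of the set of $\kappa'$ for which $\Delta(\kappa')$ is a simple polytope (with $N$ facets, that is, $\Delta(\kappa')$ affinely spans $\mathfrak t^*$, each of the $N$ sets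 $\Delta(\kappa')\cap\{\langle\eta_i,x\rangle=\kappa'_i\}$ affinely spans a hyperplane, and exactly $\dim\mathfrak t$ of these $N$ facets meet at each vertex). $c_\Delta(\kappa')$ is the center of mass of $\Delta(\kappa')$. A symmetry of a polytope is an affine map $a:\mathfrak t^*\to\mathfrak t^*$ taking the polytope to itself. A robust symmetry of $\Delta$ is a linear map $\hat a:\mathfrak t^*\to\mathfrak t^*$ such that for every $\kappa'\in\mathcal C_\Delta$ there is a symmetry $a_{\kappa'}$ of $\Delta(\kappa')$ with associated linear map $\hat a$. Facets $F_i$, $F_j$ are equivalent if there is a robust symmetry $\hat a$ such that each $a_{\kappa'}$ takes $F_i(\kappa')$ to $F_j(\kappa')$; this is an equivalence relation and its classes are viewed as subsets of $\{1,\dots,N\}$. The conormals are normalized so that for every robust symmetry $\hat a$ and every $i$ there is $j$ with $\hat a^*(\eta_i)=\eta_j$ (this is always possible). $H\in\mathfrak t$ is inessential if it can be written $H=\sum_i\beta_i\eta_i$ with $\beta_i\in\mathbb R$ and $\sum_{i\in I}\beta_i=0$ for every equivalence class $I$. *)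

theory Defs
  imports "HOL-Analysis.Analysis"
begin

(* A Euclidean space 'a serves both as t and as its dual t*: the pairing is the inner
   product, so that the dual of a linear map L on t* is "adjoint L".  No other use is made of
   the metric (volume enters only through the center of mass, which does not
   depend on the normalisation of Lebesgue measure).
   The facets are indexed by a finite type 'n, so N = CARD('n) and R^N = real ^ 'n. *)

definition polyhedron_of :: "('n::finite \<Rightarrow> 'a::euclidean_space) \<Rightarrow> real ^ 'n \<Rightarrow> 'a set" where
  "polyhedron_of \<eta> \<kappa> = (\<Inter>i. {x. \<eta> i \<bullet> x \<le> \<kappa> $ i})"

definition facet :: "('n::finite \<Rightarrow> 'a::euclidean_space) \<Rightarrow> real ^ 'n \<Rightarrow> 'n \<Rightarrow> 'a set" where
  "facet \<eta> \<kappa> i = polyhedron_of \<eta> \<kappa> \<inter> {x. \<eta> i \<bullet> x = \<kappa> $ i}"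

definition is_polytope :: "('n::finite \<Rightarrow> 'a::euclidean_space) \<Rightarrow> real ^ 'n \<Rightarrow> bool" where
  "is_polytope \<eta> \<kappa> \<longleftrightarrow>
     bounded (polyhedron_of \<eta> \<kappa>) \<and>
     affine hull (polyhedron_of \<eta> \<kappa>) = UNIV \<and>
     (\<forall>i. \<exists>a b. a \<noteq> 0 \<and> affine hull (facet \<eta> \<kappa> i) = {x. a \<bullet> x = b})"

(* The facets through a vertex are counted by index; together with is_polytope this
   forces the N facets to be pairwise distinct. *)
definition is_simple_polytope :: "('n::finite \<Rightarrow> 'a::euclidean_space) \<Rightarrow> real ^ 'n \<Rightarrow> bool" where
  "is_simple_polytope \<eta> \<kappa> \<longleftrightarrow>
     is_polytope \<eta> \<kappa> \<and>
     (\<forall>v. v extreme_point_of (polyhedron_of \<eta> \<kappa>) \<longrightarrow>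
        card {i. v \<in> facet \<eta> \<kappa> i} = DIM('a))"

definition chamber :: "('n::finite \<Rightarrow> 'a::euclidean_space) \<Rightarrow> real ^ 'n \<Rightarrow> (real ^ 'n) set" where
  "chamber \<eta> \<kappa> = connected_component_set {\<kappa>'. is_simple_polytope \<eta> \<kappa>'} \<kappa>"

definition center_of_mass :: "'a::euclidean_space set \<Rightarrow> 'a" where
  "center_of_mass S = (1 / measure lborel S) *\<^sub>R (LINT x:S|lborel. x)"

definition has_linear_part :: "('a::real_vector \<Rightarrow> 'a) \<Rightarrow> ('a \<Rightarrow> 'a) \<Rightarrow> bool" where
  "has_linear_part a L \<longleftrightarrow> linear L \<and> (\<exists>c. \<forall>x. a x = L x + c)"

definition affine_map :: "('a::real_vector \<Rightarrow> 'a) \<Rightarrow> bool" where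
  "affine_map a \<longleftrightarrow> (\<exists>L. has_linear_part a L)"

definition symmetry_of :: "'a::real_vector set \<Rightarrow> ('a \<Rightarrow> 'a) \<Rightarrow> bool" where
  "symmetry_of P a \<longleftrightarrow> affine_map a \<and> a ` P = P"

definition robust_symmetry ::
    "('n::finite \<Rightarrow> 'a::euclidean_space) \<Rightarrow> real ^ 'n \<Rightarrow> ('a \<Rightarrow> 'a) \<Rightarrow> bool" where
  "robust_symmetry \<eta> \<kappa> L \<longleftrightarrow>
     linear L \<and>
     (\<forall>\<kappa>'\<in>chamber \<eta> \<kappa>. \<exists>a. symmetry_of (polyhedron_of \<eta> \<kappa>') a \<and> has_linear_part a L)"

(* A nonempty bounded set is not invariant under a nonzero translation, so for each \<kappa>' there
   is exactly one symmetry a with linear part L, and quantifying over all such a is harmless. *)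
definition facet_equiv ::
    "('n::finite \<Rightarrow> 'a::euclidean_space) \<Rightarrow> real ^ 'n \<Rightarrow> ('n \<times> 'n) set" where
  "facet_equiv \<eta> \<kappa> = {(i, j). \<exists>L. robust_symmetry \<eta> \<kappa> L \<and>
     (\<forall>\<kappa>'\<in>chamber \<eta> \<kappa>. \<forall>a. symmetry_of (polyhedron_of \<eta> \<kappa>') a \<and> has_linear_part a L \<longrightarrow>
        a ` facet \<eta> \<kappa>' i = facet \<eta> \<kappa>' j)}"

definition facet_classes ::
    "('n::finite \<Rightarrow> 'a::euclidean_space) \<Rightarrow> real ^ 'n \<Rightarrow> 'n set set" where
  "facet_classes \<eta> \<kappa> = UNIV // facet_equiv \<eta> \<kappa>"

definition normalized_conormals ::
    "('n::finite \<Rightarrow> 'a::euclidean_space) \<Rightarrow> real ^ 'n \<Rightarrow> bool" where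
  "normalized_conormals \<eta> \<kappa> \<longleftrightarrow>
     (\<forall>L. robust_symmetry \<eta> \<kappa> L \<longrightarrow> (\<forall>i. \<exists>j. adjoint L (\<eta> i) = \<eta> j))"

definition inessential ::
    "('n::finite \<Rightarrow> 'a::euclidean_space) \<Rightarrow> real ^ 'n \<Rightarrow> 'a \<Rightarrow> bool" where
  "inessential \<eta> \<kappa> H \<longleftrightarrow>
     (\<exists>\<beta>::'n \<Rightarrow> real. H = (\<Sum>i\<in>UNIV. \<beta> i *\<^sub>R \<eta> i) \<and> (\<forall>I\<in>facet_classes \<eta> \<kappa>. (\<Sum>i\<in>I. \<beta> i) = 0))"

end

theory Submission
  imports Defs
begin

text \<open>
  Write \<open>c\<close> for the center of mass of the polytope with support numbers \<open>\<kappa>\<close>, and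
  \<open>d i = \<kappa> i - \<langle>\<eta> i, c\<rangle>\<close> for the distance from \<open>c\<close> to the \<open>i\<close>-th facet, measured by
  the conormal \<open>\<eta> i\<close>.  If \<open>H = (\<Sum>i. \<beta> i *\<^sub>R \<eta> i)\<close>, the asserted formula says
  \<open>(\<Sum>i. \<beta> i * d i) = 0\<close>.  As the \<open>\<beta> i\<close> sum to zero over each class of facets, it is enough
  that \<open>d\<close> is constant on each class (\<open>facet_distance_eq\<close>, \<open>sum_eq_0_of_quotient\<close>).

  An affine symmetry fixes the center of mass (\<open>center_of_mass_fixed\<close>), hence a symmetry with
  linear part \<open>L\<close> is the map \<open>x \<mapsto> c + L (x - c)\<close>.  Suppose that it takes the facet \<open>F i\<close> to
  \<open>F j\<close>.  By the normalization of the conormals, the adjoint of \<open>L\<close> takes \<open>\<eta> j\<close> to some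
  \<open>\<eta> m\<close>.  Then the functional \<open>\<eta> m - \<langle>\<eta> m, c\<rangle>\<close> is the pullback of
  \<open>\<eta> j - \<langle>\<eta> j, c\<rangle>\<close> by the symmetry, so that their maxima over the polytope, \<open>d m\<close> and
  \<open>d j\<close>, agree, and the sets where they are attained satisfy \<open>F m = F i\<close>.  In a simple polytope
  this forces \<open>m = i\<close> (\<open>facet_inj\<close>): otherwise \<open>\<eta> i\<close> and \<open>\<eta> m\<close> would be
  proportional, and the conormals active at a vertex of \<open>F i\<close>, as many as the dimension, could not
  span.
\<close>

section \<open>Affine maps preserving a body preserve Lebesgue measure\<close>

lemma nn_integral_lborel_translate:
  fixes f :: "'a::euclidean_space \<Rightarrow> ennreal"
  assumes [measurable]: "f \<in> borel_measurable borel"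
  shows "(\<integral>\<^sup>+x. f (t + x) \<partial>lborel) = (\<integral>\<^sup>+x. f x \<partial>lborel)"
proof -
  have "(\<integral>\<^sup>+x. f x \<partial>lborel) = (\<integral>\<^sup>+x. f x \<partial>distr lborel borel ((+) t))"
    by (simp add: lborel_distr_plus)
  then show ?thesis
    by (simp add: nn_integral_distr)
qed

lemma nn_integral_lborel_reflect:
  fixes f :: "'a::euclidean_space \<Rightarrow> ennreal"
  assumes [measurable]: "f \<in> borel_measurable borel"
  shows "(\<integral>\<^sup>+x. f (t - x) \<partial>lborel) = (\<integral>\<^sup>+x. f x \<partial>lborel)"
proof -
  have "lborel = distr lborel borel (\<lambda>x::'a. t - x)"
    using lborel_affine[of "-1" t] by (simp add: density_1)
  then have "(\<integral>\<^sup>+x. f x \<partial>lborel) = (\<integral>\<^sup>+x. f x \<partial>distr lborel borel (\<lambda>x. t - x))"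
    by simp
  then show ?thesis
    by (simp add: nn_integral_distr)
qed

text \<open>
  This is the argument for uniqueness of Haar measure, applied to Lebesgue measure and its image
  under \<open>a\<close>: up to a scalar there is only one translation-invariant measure.  It replaces the
  determinant formula for linear images, and with it any choice of coordinates.
\<close>

lemma nn_integral_lborel_affine_exchange:
  fixes f g :: "'a::euclidean_space \<Rightarrow> ennreal"
  assumes L: "linear L" and surj: "surj L" and a: "\<And>x. a x = L x + w"
    and [measurable]: "f \<in> borel_measurable borel" "g \<in> borel_measurable borel"
  shows "(\<integral>\<^sup>+x. f (a x) \<partial>lborel) * (\<integral>\<^sup>+y. g y \<partial>lborel)
       = (\<integral>\<^sup>+x. g (a x) \<partial>lborel) * (\<integral>\<^sup>+y. f y \<partial>lborel)"
proof -
  have "continuous_on UNIV a"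
    unfolding a[abs_def] using linear_continuous_on[of L UNIV] L
    by (intro continuous_intros) (simp add: linear_conv_bounded_linear)
  then have [measurable]: "a \<in> borel_measurable borel"
    by (rule borel_measurable_continuous_onI)
  have shift: "a (x - inv L y) = a x - y" for x y
    using linear_diff[OF L, of x "inv L y"] surj_f_inv_f[OF surj, of y] by (simp add: a)
  have "(\<integral>\<^sup>+x. f (a x) \<partial>lborel) * (\<integral>\<^sup>+y. g y \<partial>lborel)
      = (\<integral>\<^sup>+x. f (a x) * (\<integral>\<^sup>+y. g (a x + y) \<partial>lborel) \<partial>lborel)"
    by (simp add: nn_integral_multc nn_integral_lborel_translate[of g])
  also have "\<dots> = (\<integral>\<^sup>+x. \<integral>\<^sup>+y. f (a x) * g (a x + y) \<partial>lborel \<partial>lborel)"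
    by (simp add: nn_integral_cmult)
  also have "\<dots> = (\<integral>\<^sup>+y. \<integral>\<^sup>+x. f (a x) * g (a x + y) \<partial>lborel \<partial>lborel)"
    by (intro lborel_pair.Fubini'[symmetric]) measurable
  \<comment> \<open>Translating \<open>x\<close> by a preimage of \<open>- y\<close> under \<open>L\<close> moves \<open>y\<close> from the argument of
    \<open>g\<close> to that of \<open>f\<close>.\<close>
  also have "\<dots> = (\<integral>\<^sup>+y. \<integral>\<^sup>+x. f (a x - y) * g (a x) \<partial>lborel \<partial>lborel)"
  proof (rule nn_integral_cong)
    fix y :: 'a
    have "(\<integral>\<^sup>+x. f (a x) * g (a x + y) \<partial>lborel)
        = (\<integral>\<^sup>+x. f (a (- inv L y + x)) * g (a (- inv L y + x) + y) \<partial>lborel)"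
      by (rule nn_integral_lborel_translate[symmetric]) measurable
    then show "(\<integral>\<^sup>+x. f (a x) * g (a x + y) \<partial>lborel) = (\<integral>\<^sup>+x. f (a x - y) * g (a x) \<partial>lborel)"
      by (simp add: shift)
  qed
  also have "\<dots> = (\<integral>\<^sup>+x. \<integral>\<^sup>+y. f (a x - y) * g (a x) \<partial>lborel \<partial>lborel)"
    by (intro lborel_pair.Fubini') measurable
  also have "\<dots> = (\<integral>\<^sup>+x. (\<integral>\<^sup>+y. f (a x - y) \<partial>lborel) * g (a x) \<partial>lborel)"
    by (simp add: nn_integral_multc)
  also have "\<dots> = (\<integral>\<^sup>+x. g (a x) \<partial>lborel) * (\<integral>\<^sup>+y. f y \<partial>lborel)"
    by (simp add: nn_integral_lborel_reflect[of f] nn_integral_cmult mult.commute)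
  finally show ?thesis .
qed

text \<open>
  The scalar relating Lebesgue measure to its image is found by evaluating both on \<open>P\<close>: it is 1.
\<close>

lemma distr_lborel_affine_symmetry:
  fixes P :: "'a::euclidean_space set"
  assumes L: "linear L" and surj: "surj L" and a: "\<And>x. a x = L x + w"
    and P: "P \<in> sets borel" "emeasure lborel P \<noteq> 0" "emeasure lborel P \<noteq> \<infinity>"
    and inv: "\<And>x. a x \<in> P \<longleftrightarrow> x \<in> P"
  shows "distr lborel borel a = lborel"
proof (rule measure_eqI)
  have "continuous_on UNIV a"
    unfolding a[abs_def] using linear_continuous_on[of L UNIV] L
    by (intro continuous_intros) (simp add: linear_conv_bounded_linear)
  then have [measurable]: "a \<in> borel_measurable borel"
    by (rule borel_measurable_continuous_onI)
  fix A assume "A \<in> sets (distr lborel borel a)"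
  then have [measurable]: "A \<in> sets borel" by simp
  note [measurable] = P(1)
  have "(\<integral>\<^sup>+x. indicator A (a x) \<partial>lborel) * emeasure lborel P
      = (\<integral>\<^sup>+x. indicator P (a x) \<partial>lborel) * emeasure lborel A"
    using nn_integral_lborel_affine_exchange[OF L surj a, of "indicator A" "indicator P"] by simp
  also have "(\<integral>\<^sup>+x. indicator P (a x) \<partial>lborel) = (\<integral>\<^sup>+x. indicator P x \<partial>lborel)"
    by (intro nn_integral_cong) (simp add: indicator_def inv)
  finally have "(\<integral>\<^sup>+x. indicator A (a x) \<partial>lborel) = emeasure lborel A"
    using P by (auto simp: mult.commute[of _ "emeasure lborel P"] ennreal_mult_cancel_left)
  moreover have "emeasure (distr lborel borel a) A = (\<integral>\<^sup>+x. indicator A x \<partial>distr lborel borel a)"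
    by simp
  ultimately show "emeasure (distr lborel borel a) A = emeasure lborel A"
    by (simp add: nn_integral_distr del: nn_integral_indicator)
qed simp

lemma surj_linear_part:
  fixes P :: "'a::euclidean_space set"
  assumes L: "linear L" and a: "\<And>x. a x = L x + w"
    and hull: "affine hull P = UNIV" and "a ` P = P"
  shows "surj L"
proof -
  have im: "a ` X = (+) w ` L ` X" for X
    by (auto simp: a image_image add.commute)
  have "UNIV = affine hull (a ` P)"
    using assms by simp
  also have "\<dots> = (+) w ` L ` (affine hull P)"
    using L affine_hull_linear_image[of L P]
    by (simp add: im affine_hull_translation linear_conv_bounded_linear)
  finally have UNIV_eq: "UNIV = range (\<lambda>x. w + L x)"
    by (simp add: hull image_image)
  have "y \<in> range L" for y
  proof -
    have "w + y \<in> range (\<lambda>x. w + L x)"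
      by (subst UNIV_eq[symmetric]) simp
    then show ?thesis
      by auto
  qed
  then show ?thesis
    by blast
qed

lemma center_of_mass_fixed:
  fixes P :: "'a::euclidean_space set"
  assumes P: "compact P" "convex P" and hull: "affine hull P = UNIV"
    and L: "linear L" and a: "\<And>x. a x = L x + w" and aP: "a ` P = P"
  shows "a (center_of_mass P) = center_of_mass P"
proof -
  have surj: "surj L"
    by (rule surj_linear_part[OF L a hull aP])
  then have "inj L"
    using L linear_surjective_imp_injective by blast
  then have "inj a"
    by (auto simp: inj_def a)
  then have inv: "a x \<in> P \<longleftrightarrow> x \<in> P" for x
    using aP by (metis inj_image_mem_iff)
  have "interior P \<noteq> {}"
    using rel_interior_interior[OF hull] rel_interior_eq_empty[OF P(2)] hull by auto
  then have "\<not> negligible P"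
    using open_not_negligible[OF open_interior] negligible_subset interior_subset by metis
  then have "P \<notin> null_sets lborel"
    using null_sets_completionI negligible_iff_null_sets by metis
  then have "emeasure lborel P \<noteq> 0"
    using borel_compact[OF P(1)] by (simp add: null_sets_def)
  moreover have "emeasure lborel P \<noteq> \<infinity>"
    using emeasure_compact_finite[OF P(1)] by simp
  moreover have [measurable]: "P \<in> sets borel"
    using P(1) by (rule borel_compact)
  ultimately have distr: "distr lborel borel a = lborel"
    using distr_lborel_affine_symmetry[OF L surj a _ _ _ inv] by blast
  have vol: "measure lborel P \<noteq> 0"
    using \<open>emeasure lborel P \<noteq> 0\<close> \<open>emeasure lborel P \<noteq> \<infinity>\<close>
      emeasure_eq_ennreal_measure[of lborel P] by auto
  have bl: "bounded_linear L"
    using L by (simp add: linear_conv_bounded_linear)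
  have "continuous_on UNIV a"
    unfolding a[abs_def] using linear_continuous_on[OF bl, of UNIV]
    by (intro continuous_intros)
  then have [measurable]: "a \<in> borel_measurable borel"
    by (rule borel_measurable_continuous_onI)
  have int: "integrable lborel (\<lambda>x. indicator P x *\<^sub>R x)"
    by (rule borel_integrable_compact[OF P(1)]) (rule continuous_on_id)
  have int1: "integrable lborel (\<lambda>x. indicator P x *\<^sub>R w)"
    by (rule borel_integrable_compact[OF P(1)]) (rule continuous_on_const)
  have "(LINT x:P|lborel. x) = (LINT x|distr lborel borel a. indicator P x *\<^sub>R x)"
    by (simp add: distr set_lebesgue_integral_def)
  also have "\<dots> = (LINT x|lborel. indicator P (a x) *\<^sub>R a x)"
    by (rule integral_distr) auto
  also have "\<dots> = (LINT x|lborel. L (indicator P x *\<^sub>R x) + indicator P x *\<^sub>R w)"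
    by (intro Bochner_Integration.integral_cong refl)
       (simp add: indicator_def inv linear_0[OF L] flip: a)
  also have "\<dots> = L (LINT x|lborel. indicator P x *\<^sub>R x) + (LINT x|lborel. indicator P x *\<^sub>R w)"
    using Bochner_Integration.integral_add[OF integrable_bounded_linear[OF bl int] int1]
      integral_bounded_linear[OF bl int] by simp
  also have "(LINT x|lborel. indicator P x *\<^sub>R w) = measure lborel P *\<^sub>R w"
    using \<open>emeasure lborel P \<noteq> \<infinity>\<close>
    by (subst integral_scaleR_left) (auto simp: top.not_eq_extremum)
  finally have "(LINT x:P|lborel. x) = L (LINT x:P|lborel. x) + measure lborel P *\<^sub>R w"
    by (simp add: set_lebesgue_integral_def)
  from arg_cong[OF this, of "\<lambda>z. (1 / measure lborel P) *\<^sub>R z"]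
  have "center_of_mass P = L (center_of_mass P) + w"
    unfolding center_of_mass_def linear_cmul[OF L] using vol by (simp add: scaleR_add_right)
  then show ?thesis
    by (metis a)
qed

section \<open>Symmetries of a polytope and the equivalence of facets\<close>

lemma polyhedron_of_geometry:
  assumes "is_polytope \<eta> \<kappa>"
  shows "compact (polyhedron_of \<eta> \<kappa>)" and "convex (polyhedron_of \<eta> \<kappa>)"
    and "affine hull (polyhedron_of \<eta> \<kappa>) = UNIV"
proof -
  have "closed (polyhedron_of \<eta> \<kappa>)"
    unfolding polyhedron_of_def by (intro closed_INT ballI closed_halfspace_le)
  then show "compact (polyhedron_of \<eta> \<kappa>)"
    using assms by (simp add: is_polytope_def compact_eq_bounded_closed)
  show "convex (polyhedron_of \<eta> \<kappa>)"
    unfolding polyhedron_of_def by (intro convex_INT convex_halfspace_le)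
  show "affine hull (polyhedron_of \<eta> \<kappa>) = UNIV"
    using assms by (simp add: is_polytope_def)
qed

lemma chamber_simple: "\<kappa> \<in> chamber \<eta> \<kappa>\<^sub>0 \<Longrightarrow> is_simple_polytope \<eta> \<kappa>"
  unfolding chamber_def using connected_component_subset by blast

lemma chamber_polytope: "\<kappa> \<in> chamber \<eta> \<kappa>\<^sub>0 \<Longrightarrow> is_polytope \<eta> \<kappa>"
  using chamber_simple is_simple_polytope_def by blast

lemma chamber_base: "is_simple_polytope \<eta> \<kappa>\<^sub>0 \<Longrightarrow> \<kappa>\<^sub>0 \<in> chamber \<eta> \<kappa>\<^sub>0"
  unfolding chamber_def by (simp add: connected_component_refl)

text \<open>The affine map with linear part \<open>L\<close> that fixes the point \<open>c\<close> (for linear \<open>L\<close>).\<close>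

definition affine_about :: "'a::real_vector \<Rightarrow> ('a \<Rightarrow> 'a) \<Rightarrow> 'a \<Rightarrow> 'a" where
  "affine_about c L x = c + L (x - c)"

text \<open>
  The only candidate for a symmetry of the polytope whose linear part is a given map, since
  symmetries fix the center of mass.
\<close>

abbreviation symmetry_with ::
    "('n::finite \<Rightarrow> 'a::euclidean_space) \<Rightarrow> real ^ 'n \<Rightarrow> ('a \<Rightarrow> 'a) \<Rightarrow> 'a \<Rightarrow> 'a" where
  "symmetry_with \<eta> \<kappa> \<equiv> affine_about (center_of_mass (polyhedron_of \<eta> \<kappa>))"

lemma affine_about_linear:
  "linear L \<Longrightarrow> affine_about c L x = L x + (c - L c)"
  by (simp add: affine_about_def linear_diff)

lemma affine_about_id: "affine_about c (\<lambda>x. x) = (\<lambda>x. x)"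
  by (simp add: affine_about_def fun_eq_iff)

lemma affine_about_comp: "affine_about c M ` affine_about c L ` X = affine_about c (M \<circ> L) ` X"
  by (simp add: affine_about_def image_image)

text \<open>
  Thus quantifiers over symmetries with a given linear part can be replaced by the single map
  \<open>symmetry_with\<close>, which makes composition and inversion of robust symmetries immediate.
\<close>

lemma symmetry_iff_affine_about:
  assumes poly: "is_polytope \<eta> \<kappa>"
  shows "symmetry_of (polyhedron_of \<eta> \<kappa>) a \<and> has_linear_part a L \<longleftrightarrow>
         linear L \<and> a = symmetry_with \<eta> \<kappa> L \<and> a ` polyhedron_of \<eta> \<kappa> = polyhedron_of \<eta> \<kappa>"
proof (intro iffI conjI; (elim conjE)?)
  let ?c = "center_of_mass (polyhedron_of \<eta> \<kappa>)"
  assume sym: "symmetry_of (polyhedron_of \<eta> \<kappa>) a" and lin: "has_linear_part a L"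
  then show L: "linear L" and im: "a ` polyhedron_of \<eta> \<kappa> = polyhedron_of \<eta> \<kappa>"
    by (auto simp: symmetry_of_def has_linear_part_def)
  from lin obtain w where a: "\<And>x. a x = L x + w"
    by (auto simp: has_linear_part_def)
  have "L ?c + w = ?c"
    using center_of_mass_fixed[OF polyhedron_of_geometry[OF poly] L a im] by (simp add: a)
  then show "a = symmetry_with \<eta> \<kappa> L"
    by (auto simp: fun_eq_iff a affine_about_linear[OF L] algebra_simps)
next
  let ?c = "center_of_mass (polyhedron_of \<eta> \<kappa>)"
  assume L: "linear L" and a: "a = symmetry_with \<eta> \<kappa> L"
    and im: "a ` polyhedron_of \<eta> \<kappa> = polyhedron_of \<eta> \<kappa>"
  show lin: "has_linear_part a L"
    using L affine_about_linear[OF L] by (auto simp: has_linear_part_def a)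
  then show "symmetry_of (polyhedron_of \<eta> \<kappa>) a"
    using im by (auto simp: symmetry_of_def affine_map_def)
qed

lemma robust_symmetry_iff:
  "robust_symmetry \<eta> \<kappa>\<^sub>0 L \<longleftrightarrow> linear L \<and>
     (\<forall>\<kappa>\<in>chamber \<eta> \<kappa>\<^sub>0. symmetry_with \<eta> \<kappa> L ` polyhedron_of \<eta> \<kappa> = polyhedron_of \<eta> \<kappa>)"
  unfolding robust_symmetry_def
  by (intro conj_cong refl ball_cong) (auto simp: symmetry_iff_affine_about[OF chamber_polytope])

text \<open>
  \<open>L\<close> is a robust symmetry which, throughout the chamber, carries the \<open>i\<close>-th facet to the
  \<open>j\<close>-th.  The affine symmetry is given explicitly by \<open>symmetry_with\<close>.
\<close>

definition facet_symmetry ::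
    "('n::finite \<Rightarrow> 'a::euclidean_space) \<Rightarrow> real ^ 'n \<Rightarrow> ('a \<Rightarrow> 'a) \<Rightarrow> 'n \<Rightarrow> 'n \<Rightarrow> bool" where
  "facet_symmetry \<eta> \<kappa>\<^sub>0 L i j \<longleftrightarrow> robust_symmetry \<eta> \<kappa>\<^sub>0 L \<and>
     (\<forall>\<kappa>\<in>chamber \<eta> \<kappa>\<^sub>0. symmetry_with \<eta> \<kappa> L ` facet \<eta> \<kappa> i = facet \<eta> \<kappa> j)"

lemma facet_equiv_iff: "(i, j) \<in> facet_equiv \<eta> \<kappa>\<^sub>0 \<longleftrightarrow> (\<exists>L. facet_symmetry \<eta> \<kappa>\<^sub>0 L i j)"
proof -
  have "(\<forall>\<kappa>\<in>chamber \<eta> \<kappa>\<^sub>0. \<forall>a. symmetry_of (polyhedron_of \<eta> \<kappa>) a \<and> has_linear_part a L \<longrightarrow>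
          a ` facet \<eta> \<kappa> i = facet \<eta> \<kappa> j) \<longleftrightarrow>
        (\<forall>\<kappa>\<in>chamber \<eta> \<kappa>\<^sub>0. symmetry_with \<eta> \<kappa> L ` facet \<eta> \<kappa> i = facet \<eta> \<kappa> j)"
    if "robust_symmetry \<eta> \<kappa>\<^sub>0 L" for L
    using that unfolding robust_symmetry_iff
    by (intro ball_cong refl) (auto simp: symmetry_iff_affine_about[OF chamber_polytope])
  then show ?thesis
    unfolding facet_equiv_def facet_symmetry_def by blast
qed

lemma bij_robust_symmetry:
  fixes \<eta> :: "'n::finite \<Rightarrow> 'a::euclidean_space"
  assumes "is_simple_polytope \<eta> \<kappa>\<^sub>0" "robust_symmetry \<eta> \<kappa>\<^sub>0 L"
  shows "bij L"
proof -
  let ?c = "center_of_mass (polyhedron_of \<eta> \<kappa>\<^sub>0)"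
  have L: "linear L"
    and im: "symmetry_with \<eta> \<kappa>\<^sub>0 L ` polyhedron_of \<eta> \<kappa>\<^sub>0 = polyhedron_of \<eta> \<kappa>\<^sub>0"
    using assms chamber_base[OF assms(1)] by (auto simp: robust_symmetry_iff)
  have "is_polytope \<eta> \<kappa>\<^sub>0"
    using assms by (simp add: is_simple_polytope_def)
  from surj_linear_part[OF L affine_about_linear[OF L] polyhedron_of_geometry(3)[OF this] im]
  have "surj L" .
  then show ?thesis
    using linear_surjective_imp_injective[OF L] by (simp add: bij_def)
qed

lemma equiv_facet_equiv:
  fixes \<eta> :: "'n::finite \<Rightarrow> 'a::euclidean_space"
  assumes simple: "is_simple_polytope \<eta> \<kappa>\<^sub>0"
  shows "equiv UNIV (facet_equiv \<eta> \<kappa>\<^sub>0)"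
proof (rule equivI)
  have "facet_symmetry \<eta> \<kappa>\<^sub>0 (\<lambda>x. x) i i" for i
    by (simp add: facet_symmetry_def robust_symmetry_iff affine_about_id linear_id[unfolded id_def])
  then show "refl_on UNIV (facet_equiv \<eta> \<kappa>\<^sub>0)"
    by (auto simp: refl_on_def facet_equiv_iff)
  show "sym (facet_equiv \<eta> \<kappa>\<^sub>0)"
  proof (rule symI)
    fix i j assume "(i, j) \<in> facet_equiv \<eta> \<kappa>\<^sub>0"
    then obtain L where L: "facet_symmetry \<eta> \<kappa>\<^sub>0 L i j"
      by (auto simp: facet_equiv_iff)
    then have "bij L" "linear L"
      using bij_robust_symmetry[OF simple] by (auto simp: facet_symmetry_def robust_symmetry_iff)
    then have "linear (inv L)"
      using bij_is_inj bij_is_surj inj_linear_imp_inv_linear by blast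
    moreover have "affine_about c (inv L) ` affine_about c L ` X = X" for c and X :: "'a set"
      using \<open>bij L\<close> by (simp add: affine_about_comp bij_is_inj id_def affine_about_id)
    ultimately have "facet_symmetry \<eta> \<kappa>\<^sub>0 (inv L) j i"
      using L unfolding facet_symmetry_def robust_symmetry_iff by metis
    then show "(j, i) \<in> facet_equiv \<eta> \<kappa>\<^sub>0"
      by (auto simp: facet_equiv_iff)
  qed
  show "trans (facet_equiv \<eta> \<kappa>\<^sub>0)"
  proof (rule transI)
    fix i j k assume "(i, j) \<in> facet_equiv \<eta> \<kappa>\<^sub>0" "(j, k) \<in> facet_equiv \<eta> \<kappa>\<^sub>0"
    then obtain L M where "facet_symmetry \<eta> \<kappa>\<^sub>0 L i j" "facet_symmetry \<eta> \<kappa>\<^sub>0 M j k"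
      by (auto simp: facet_equiv_iff)
    then have "facet_symmetry \<eta> \<kappa>\<^sub>0 (M \<circ> L) i k"
      unfolding facet_symmetry_def robust_symmetry_iff
      by (simp add: affine_about_comp[symmetric] linear_compose)
    then show "(i, k) \<in> facet_equiv \<eta> \<kappa>\<^sub>0"
      by (auto simp: facet_equiv_iff)
  qed
qed simp

section \<open>Facets of a simple polytope determine their indices\<close>

text \<open>Otherwise the component of \<open>e\<close> orthogonal to \<open>a\<close> would vary along the hyperplane.\<close>

lemma functional_constant_on_hyperplane:
  fixes a e :: "'a::euclidean_space"
  assumes "a \<noteq> 0" and const: "\<And>x. a \<bullet> x = b \<Longrightarrow> e \<bullet> x = k"
  shows "e \<in> span {a}"
proof -
  define x where "x = (b / (a \<bullet> a)) *\<^sub>R a"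
  define u where "u = e - ((e \<bullet> a) / (a \<bullet> a)) *\<^sub>R a"
  have "a \<bullet> x = b" "a \<bullet> u = 0"
    using \<open>a \<noteq> 0\<close> by (simp_all add: x_def u_def inner_diff_right inner_commute)
  then have "e \<bullet> x = k" "e \<bullet> (x + u) = k"
    using const[of x] const[of "x + u"] by (simp_all add: inner_add_right)
  then have "e \<bullet> u = 0"
    by (simp add: inner_add_right)
  then have "u \<bullet> u = 0"
    using \<open>a \<bullet> u = 0\<close> by (simp add: u_def inner_diff_left)
  then have "e = ((e \<bullet> a) / (a \<bullet> a)) *\<^sub>R a"
    by (simp add: u_def)
  then show ?thesis
    by (metis insertI1 span_base span_scale)
qed

text \<open>
  A direction orthogonal to all conormals active at \<open>v\<close> could be followed both ways inside the
  polyhedron, since the inactive inequalities are strict near \<open>v\<close>.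
\<close>

lemma dim_active_conormals:
  fixes \<eta> :: "'n::finite \<Rightarrow> 'a::euclidean_space"
  assumes v: "v extreme_point_of polyhedron_of \<eta> \<kappa>"
  shows "dim (\<eta> ` {i. v \<in> facet \<eta> \<kappa> i}) = DIM('a)"
proof (rule ccontr)
  let ?A = "{i. v \<in> facet \<eta> \<kappa> i}"
  assume "dim (\<eta> ` ?A) \<noteq> DIM('a)"
  then have "dim (\<eta> ` ?A) < DIM('a)"
    using dim_subset_UNIV[of "\<eta> ` ?A"] by linarith
  then obtain u where "u \<noteq> 0" and "\<And>y. y \<in> span (\<eta> ` ?A) \<Longrightarrow> orthogonal u y"
    using orthogonal_to_subspace_exists[of "\<eta> ` ?A"] by metis
  then have u: "\<eta> i \<bullet> u = 0" if "i \<in> ?A" for i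
    using that by (metis imageI inner_commute orthogonal_def span_base)
  have vP: "v \<in> polyhedron_of \<eta> \<kappa>"
    using v by (simp add: extreme_point_of_def)
  define U where "U = (\<Inter>i\<in>-?A. {x. \<eta> i \<bullet> x < \<kappa> $ i})"
  have "open U"
    unfolding U_def by (intro open_INT) (auto simp: open_halfspace_lt)
  moreover have "v \<in> U"
    using vP by (auto simp: U_def facet_def polyhedron_of_def less_le)
  ultimately obtain e where "e > 0" and e: "ball v e \<subseteq> U"
    using open_contains_ball by blast
  define h where "h = (e / (2 * norm u)) *\<^sub>R u"
  have h: "norm h < e" "h \<noteq> 0"
    using \<open>e > 0\<close> \<open>u \<noteq> 0\<close> by (auto simp: h_def)
  have move: "v + z \<in> polyhedron_of \<eta> \<kappa>" if "norm z < e" "\<And>i. i \<in> ?A \<Longrightarrow> \<eta> i \<bullet> z = 0" for z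
  proof -
    have "v + z \<in> U"
      using e that(1) by (auto simp: dist_norm)
    then have "\<eta> i \<bullet> (v + z) < \<kappa> $ i" if "i \<notin> ?A" for i
      using that by (auto simp: U_def)
    moreover have "\<eta> i \<bullet> (v + z) \<le> \<kappa> $ i" if "i \<in> ?A" for i
      using that \<open>\<And>i. i \<in> ?A \<Longrightarrow> \<eta> i \<bullet> z = 0\<close>[of i] by (simp add: facet_def inner_add_right)
    ultimately have "\<eta> i \<bullet> (v + z) \<le> \<kappa> $ i" for i
      by (metis less_imp_le)
    then show ?thesis
      by (simp add: polyhedron_of_def)
  qed
  have "v + h \<in> polyhedron_of \<eta> \<kappa>" "v + (- h) \<in> polyhedron_of \<eta> \<kappa>"
    using h u move[of h] move[of "- h"] by (simp_all add: h_def)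
  moreover have "midpoint (v + h) (v + (- h)) = v"
    by (simp add: midpoint_def scaleR_2[symmetric])
  moreover have "h + h \<noteq> 0"
    using h(2) by (simp add: scaleR_2[symmetric])
  then have "v + h \<noteq> v + (- h)"
    by (simp add: eq_neg_iff_add_eq_0)
  ultimately show False
    using v midpoint_in_open_segment[of "v + h" "v + (- h)"] by (simp add: extreme_point_of_def)
qed

lemma facet_nonempty:
  assumes "is_polytope \<eta> \<kappa>"
  shows "facet \<eta> \<kappa> i \<noteq> {}"
proof
  obtain a b where "a \<noteq> 0" and hull: "affine hull (facet \<eta> \<kappa> i) = {x. a \<bullet> x = b}"
    using assms unfolding is_polytope_def by blast
  assume "facet \<eta> \<kappa> i = {}"
  then show False
    using hull \<open>a \<noteq> 0\<close> by (metis affine_hull_empty hyperplane_eq_empty)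
qed

text \<open>
  Two indices with the same facet would both be active at a vertex of that facet, with proportional
  conormals.  The \<open>DIM('a)\<close> active conormals would then span at most \<open>DIM('a) - 1\<close>
  dimensions.
\<close>

lemma facet_inj:
  fixes \<eta> :: "'n::finite \<Rightarrow> 'a::euclidean_space"
  assumes simple: "is_simple_polytope \<eta> \<kappa>" and eq: "facet \<eta> \<kappa> i = facet \<eta> \<kappa> j"
  shows "i = j"
proof (rule ccontr)
  assume "i \<noteq> j"
  have poly: "is_polytope \<eta> \<kappa>"
    using simple by (simp add: is_simple_polytope_def)
  then obtain a b where "a \<noteq> 0" and hull: "affine hull (facet \<eta> \<kappa> i) = {x. a \<bullet> x = b}"
    unfolding is_polytope_def by blast
  have spn: "\<eta> m \<in> span {a}" if "facet \<eta> \<kappa> m = facet \<eta> \<kappa> i" for m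
  proof -
    have "facet \<eta> \<kappa> m \<subseteq> {x. \<eta> m \<bullet> x = \<kappa> $ m}"
      by (auto simp: facet_def)
    then have "affine hull (facet \<eta> \<kappa> i) \<subseteq> {x. \<eta> m \<bullet> x = \<kappa> $ m}"
      unfolding that by (intro hull_minimal affine_hyperplane)
    then show ?thesis
      using functional_constant_on_hyperplane[OF \<open>a \<noteq> 0\<close>, of b] unfolding hull by blast
  qed
  have face: "facet \<eta> \<kappa> i face_of polyhedron_of \<eta> \<kappa>"
    unfolding facet_def
    by (intro face_of_Int_supporting_hyperplane_le polyhedron_of_geometry(2)[OF poly])
       (auto simp: polyhedron_of_def)
  have "facet \<eta> \<kappa> i \<noteq> {}"
    using facet_nonempty[OF poly] .
  moreover have "compact (facet \<eta> \<kappa> i)" "convex (facet \<eta> \<kappa> i)"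
    using face face_of_imp_compact face_of_imp_convex polyhedron_of_geometry[OF poly] by blast+
  ultimately obtain v where "v extreme_point_of facet \<eta> \<kappa> i"
    using extreme_point_exists_convex by blast
  then have v: "v extreme_point_of polyhedron_of \<eta> \<kappa>" "v \<in> facet \<eta> \<kappa> i"
    using extreme_point_of_face[OF face] by auto
  let ?A = "{m. v \<in> facet \<eta> \<kappa> m}"
  have card: "card ?A = DIM('a)"
    using simple v(1) by (simp add: is_simple_polytope_def)
  have ij: "i \<in> ?A" "j \<in> ?A"
    using v(2) eq by auto
  have "\<eta> ` ?A \<subseteq> span (insert a (\<eta> ` (?A - {i, j})))"
  proof (rule image_subsetI)
    fix m assume "m \<in> ?A"
    show "\<eta> m \<in> span (insert a (\<eta> ` (?A - {i, j})))"
    proof (cases "m = i \<or> m = j")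
      case True
      then have "\<eta> m \<in> span {a}"
        using spn eq by metis
      then show ?thesis
        using span_mono[of "{a}"] by blast
    next
      case False
      then show ?thesis
        using \<open>m \<in> ?A\<close> by (intro span_base) auto
    qed
  qed
  then have "DIM('a) \<le> card (insert a (\<eta> ` (?A - {i, j})))"
    using dim_active_conormals[OF v(1)] dim_le_card by (metis finite finite_imageI finite_insert)
  also have "\<dots> \<le> Suc (card (\<eta> ` (?A - {i, j})))"
    by (simp add: card_insert_if)
  also have "\<dots> \<le> Suc (card (?A - {i, j}))"
    by (simp add: card_image_le)
  also have "\<dots> < card ?A"
    using ij \<open>i \<noteq> j\<close> card_Diff_subset[of "{i, j}" ?A] card_mono[of ?A "{i, j}"] by simp
  finally show False
    using card by simp
qed

section \<open>Equivalent facets are equally far from the center of mass\<close>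

text \<open>
  The distance to a facet is measured by the given conormals, which need not be unit vectors; their
  normalization is what makes distances to equivalent facets comparable.
\<close>

lemma facet_distance_eq:
  assumes simple: "is_simple_polytope \<eta> \<kappa>\<^sub>0" and norm: "normalized_conormals \<eta> \<kappa>\<^sub>0"
    and equiv: "(i, j) \<in> facet_equiv \<eta> \<kappa>\<^sub>0" and \<kappa>: "\<kappa> \<in> chamber \<eta> \<kappa>\<^sub>0"
  defines "c \<equiv> center_of_mass (polyhedron_of \<eta> \<kappa>)"
  shows "\<kappa> $ i - \<eta> i \<bullet> c = \<kappa> $ j - \<eta> j \<bullet> c"
proof -
  obtain L where L: "facet_symmetry \<eta> \<kappa>\<^sub>0 L i j"
    using equiv by (auto simp: facet_equiv_iff)
  then have robust: "robust_symmetry \<eta> \<kappa>\<^sub>0 L" and lin: "linear L"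
    by (auto simp: facet_symmetry_def robust_symmetry_iff)
  let ?P = "polyhedron_of \<eta> \<kappa>" and ?a = "affine_about c L"
  have P: "?a ` ?P = ?P" and F: "?a ` facet \<eta> \<kappa> i = facet \<eta> \<kappa> j"
    using L \<kappa> by (auto simp: facet_symmetry_def robust_symmetry_iff c_def)
  have "inj ?a"
    using bij_robust_symmetry[OF simple robust] unfolding bij_def inj_def affine_about_def
    by (metis add_left_cancel diff_add_cancel)
  obtain m where "adjoint L (\<eta> j) = \<eta> m"
    using norm robust by (auto simp: normalized_conormals_def)
  then have m: "\<eta> m \<bullet> x = \<eta> j \<bullet> L x" for x
    using adjoint_works[OF lin, of x "\<eta> j"] by (simp add: inner_commute)
  \<comment> \<open>Relative to their values at \<open>c\<close>, \<open>\<eta> m\<close> is the pullback of \<open>\<eta> j\<close> by the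
    symmetry.  The two inequalities below compare their maxima over the polytope, evaluated at a
    point of \<open>F m\<close> and of \<open>F i\<close> respectively.\<close>
  have pull: "\<eta> j \<bullet> ?a x = \<eta> m \<bullet> x + (\<eta> j \<bullet> c - \<eta> m \<bullet> c)" for x
    by (simp add: m affine_about_linear[OF lin] inner_add_right inner_diff_right)
  have poly: "is_polytope \<eta> \<kappa>"
    using chamber_polytope[OF \<kappa>] .
  have "\<kappa> $ m \<le> \<kappa> $ j - (\<eta> j \<bullet> c - \<eta> m \<bullet> c)"
  proof -
    obtain x where "x \<in> facet \<eta> \<kappa> m"
      using facet_nonempty[OF poly] by blast
    moreover from this have "?a x \<in> ?P"
      using P by (auto simp: facet_def)
    then have "\<eta> j \<bullet> ?a x \<le> \<kappa> $ j"
      by (auto simp: polyhedron_of_def)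
    ultimately show ?thesis
      using pull[of x] by (simp add: facet_def)
  qed
  moreover have "\<kappa> $ j - (\<eta> j \<bullet> c - \<eta> m \<bullet> c) \<le> \<kappa> $ m"
  proof -
    obtain x where x: "x \<in> facet \<eta> \<kappa> i"
      using facet_nonempty[OF poly] by blast
    then have "?a x \<in> facet \<eta> \<kappa> j"
      using F by blast
    moreover have "\<eta> m \<bullet> x \<le> \<kappa> $ m"
      using x by (auto simp: facet_def polyhedron_of_def)
    ultimately show ?thesis
      using pull[of x] by (simp add: facet_def)
  qed
  ultimately have dist: "\<kappa> $ m - \<eta> m \<bullet> c = \<kappa> $ j - \<eta> j \<bullet> c"
    by linarith
  have "facet \<eta> \<kappa> m = facet \<eta> \<kappa> i"
  proof (rule set_eqI)
    fix x
    have "x \<in> facet \<eta> \<kappa> m \<longleftrightarrow> ?a x \<in> facet \<eta> \<kappa> j"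
      using inj_image_mem_iff[OF \<open>inj ?a\<close>, of x ?P] P pull[of x] dist
      by (auto simp: facet_def)
    also have "\<dots> \<longleftrightarrow> x \<in> facet \<eta> \<kappa> i"
      using inj_image_mem_iff[OF \<open>inj ?a\<close>] F by metis
    finally show "x \<in> facet \<eta> \<kappa> m \<longleftrightarrow> x \<in> facet \<eta> \<kappa> i" .
  qed
  then have "m = i"
    using facet_inj chamber_simple[OF \<kappa>] by metis
  then show ?thesis
    using dist by simp
qed

lemma sum_eq_0_of_quotient:
  fixes \<beta> d :: "'n::finite \<Rightarrow> real"
  assumes R: "equiv UNIV R" and d: "\<And>i j. (i, j) \<in> R \<Longrightarrow> d i = d j"
    and \<beta>: "\<forall>I\<in>UNIV // R. (\<Sum>i\<in>I. \<beta> i) = 0"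
  shows "(\<Sum>i\<in>UNIV. \<beta> i * d i) = 0"
proof -
  have "(\<Sum>i\<in>UNIV. \<beta> i * d i) = (\<Sum>i\<in>\<Union>(UNIV // R). \<beta> i * d i)"
    using Union_quotient[OF R] by simp
  also have "\<dots> = (\<Sum>I\<in>UNIV // R. \<Sum>i\<in>I. \<beta> i * d i)"
    using quotient_disj[OF R] by (subst sum.Union_disjoint) auto
  also have "\<dots> = 0"
  proof (rule sum.neutral, rule ballI)
    fix I assume I: "I \<in> UNIV // R"
    then obtain k where k: "I = R `` {k}"
      by (auto simp: quotient_def)
    then have "(\<Sum>i\<in>I. \<beta> i * d i) = (\<Sum>i\<in>I. \<beta> i * d k)"
      using d by (intro sum.cong) auto
    also have "\<dots> = (\<Sum>i\<in>I. \<beta> i) * d k"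
      by (rule sum_distrib_right[symmetric])
    finally have "(\<Sum>i\<in>I. \<beta> i * d i) = (\<Sum>i\<in>I. \<beta> i) * d k" .
    then show "(\<Sum>i\<in>I. \<beta> i * d i) = 0"
      using \<beta> I by simp
  qed
  finally show ?thesis .
qed

theorem proposition1p18:
  fixes \<eta> :: "'n::finite \<Rightarrow> 'a::euclidean_space"
    and \<kappa>\<^sub>0 :: "real ^ 'n"
    and H :: 'a
    and \<beta> :: "'n \<Rightarrow> real"
  assumes "is_simple_polytope \<eta> \<kappa>\<^sub>0"
    and "normalized_conormals \<eta> \<kappa>\<^sub>0"
    and "inessential \<eta> \<kappa>\<^sub>0 H"
    and "H = (\<Sum>i\<in>UNIV. \<beta> i *\<^sub>R \<eta> i)"
    and "\<forall>I\<in>facet_classes \<eta> \<kappa>\<^sub>0. (\<Sum>i\<in>I. \<beta> i) = 0"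
  shows "\<forall>\<kappa>\<in>chamber \<eta> \<kappa>\<^sub>0.
    H \<bullet> center_of_mass (polyhedron_of \<eta> \<kappa>) = (\<Sum>i\<in>UNIV. \<beta> i * \<kappa> $ i)"
proof
  fix \<kappa> assume \<kappa>: "\<kappa> \<in> chamber \<eta> \<kappa>\<^sub>0"
  let ?c = "center_of_mass (polyhedron_of \<eta> \<kappa>)"
  have "(\<Sum>i\<in>UNIV. \<beta> i * (\<kappa> $ i - \<eta> i \<bullet> ?c)) = 0"
    by (rule sum_eq_0_of_quotient[OF equiv_facet_equiv[OF assms(1)]
          facet_distance_eq[OF assms(1,2) _ \<kappa>] assms(5)[unfolded facet_classes_def]])
  then show "H \<bullet> ?c = (\<Sum>i\<in>UNIV. \<beta> i * \<kappa> $ i)"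
    by (simp add: assms(4) inner_sum_left right_diff_distrib sum_subtractf)
qed

end
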